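(* Let $Q$ be a quadrature formula on $[-1,1]$, i.e. $Q[f] = \sum_{j=1}^{\ell} a_j f(x_j)$ with nodes $-1 \le x_1 < x_2 < \cdots < x_\ell \le 1$ and weights $a_j \in \mathbb{R}$. Assume that, for some $m \in \mathbb{N}_0$, $Q[p] = \int_{-1}^1 p(x)\,\mathrm{d}x$ for all polynomials $p$ of degree at most $m$. For $n \in \mathbb{N}$ let $Q^{(n)}$ be the $n$-fold compound quadrature formula with respect to the elementary formula $Q$, that is, $$Q^{(n)}[f] := \frac1n \sum_{\nu=1}^n \sum_{j=1}^\ell a_j f\left(-1 + \frac1n (x_j + 2\nu - 1)\right).$$ Then for every $s \in \{0,1,\ldots,m\}$ there exists a constant $C$, depending only on $Q$ and $s$, such that for all $n \in \mathbb{N}$ and all $f \in V_s$, $$\left| \int_{-1}^1 f(x)\,\mathrm{d}x - Q^{(n)}[f] \right| \le C\, n^{-s-1} \operatorname{Var} f^{(s)}.$$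
   Context: $\operatorname{Var} g$ denotes the total variation of a function $g$ over the interval $[-1,1]$. The function classes are $V_0 := \{ f : [-1,1] \to \mathbb{R} : \operatorname{Var} f < \infty \}$ and, for $s \in \mathbb{N} = \{1,2,\ldots\}$, $V_s := \{ f : [-1,1] \to \mathbb{R} : f^{(s-1)} \text{ is absolutely continuous and } \operatorname{Var} f^{(s)} < \infty \}$. For $s \ge 1$, absolute continuity of $f^{(s-1)}$ yields $f^{(s)}$ only almost everywhere; $f^{(s)}$ is understood as a function on $[-1,1]$ of finite total variation that agrees almost everywhere with the derivative of $f^{(s-1)}$. *)

theory Defs
  imports "HOL-Analysis.Analysis" "HOL-Computational_Algebra.Polynomial"
begin

text \<open>
  Functions \<open>[-1,1] \<rightarrow> \<real>\<close> are modelled by total functions \<open>real \<Rightarrow> real\<close>; all notions below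
  depend only on the values on the interval.
\<close>

definition total_variation :: "real \<Rightarrow> real \<Rightarrow> (real \<Rightarrow> real) \<Rightarrow> ennreal" where
  "total_variation a b g =
     (SUP (N, t) \<in> {(N, t). mono_on {..N} t \<and> t ` {..N} \<subseteq> {a..b}}.
        ennreal (\<Sum>i<(N::nat). \<bar>g (t (Suc i)) - g (t i)\<bar>))"

definition absolutely_continuous_fun :: "real \<Rightarrow> real \<Rightarrow> (real \<Rightarrow> real) \<Rightarrow> bool" where
  "absolutely_continuous_fun a b h \<longleftrightarrow>
     (\<forall>e>0. \<exists>d>0. \<forall>(N::nat) (u::nat \<Rightarrow> real) v.
        (\<forall>i<N. a \<le> u i \<and> u i \<le> v i \<and> v i \<le> b) \<and>
        disjoint_family_on (\<lambda>i. {u i<..<v i}) {..<N} \<and>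
        (\<Sum>i<N. v i - u i) < d
        \<longrightarrow> (\<Sum>i<N. \<bar>h (v i) - h (u i)\<bar>) < e)"

text \<open>
  \<open>f\<close> is \<open>k\<close> times differentiable at every point of \<open>[a,b]\<close> (one-sidedly at the end points),
  with \<open>k\<close>-th derivative \<open>g\<close>.
\<close>

fun kth_derivative_on :: "real \<Rightarrow> real \<Rightarrow> nat \<Rightarrow> (real \<Rightarrow> real) \<Rightarrow> (real \<Rightarrow> real) \<Rightarrow> bool" where
  "kth_derivative_on a b 0 f g \<longleftrightarrow> (\<forall>x\<in>{a..b}. g x = f x)"
| "kth_derivative_on a b (Suc k) f g \<longleftrightarrow>
     (\<exists>h. kth_derivative_on a b k f h \<and>
          (\<forall>x\<in>{a..b}. (h has_real_derivative g x) (at x within {a..b})))"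

text \<open>
  \<open>g\<close> is a version of the \<open>s\<close>-th derivative of \<open>f\<close> on \<open>[-1,1]\<close>: it has finite total variation and, for \<open>s \<ge> 1\<close>,
  the derivative of order \<open>s - 1\<close> is absolutely continuous and \<open>g\<close> is its derivative almost everywhere. For
  \<open>s \<ge> 1\<close> such a \<open>g\<close> is not unique.
\<close>

fun bv_derivative :: "nat \<Rightarrow> (real \<Rightarrow> real) \<Rightarrow> (real \<Rightarrow> real) \<Rightarrow> bool" where
  "bv_derivative 0 f g \<longleftrightarrow> (\<forall>x\<in>{-1..1}. g x = f x) \<and> total_variation (-1) 1 g < \<infinity>"
| "bv_derivative (Suc k) f g \<longleftrightarrow>
     (\<exists>h. kth_derivative_on (-1) 1 k f h \<and> absolutely_continuous_fun (-1) 1 h \<and>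
          (AE x in lebesgue_on {-1..1}. (h has_real_derivative g x) (at x within {-1..1}))) \<and>
     total_variation (-1) 1 g < \<infinity>"

definition V_class :: "nat \<Rightarrow> (real \<Rightarrow> real) set" where
  "V_class s = {f. \<exists>g. bv_derivative s f g}"

definition quadrature ::
    "nat \<Rightarrow> (nat \<Rightarrow> real) \<Rightarrow> (nat \<Rightarrow> real) \<Rightarrow> (real \<Rightarrow> real) \<Rightarrow> real" where
  "quadrature l a x f = (\<Sum>j=1..l. a j * f (x j))"

definition compound_quadrature ::
    "nat \<Rightarrow> (nat \<Rightarrow> real) \<Rightarrow> (nat \<Rightarrow> real) \<Rightarrow> nat \<Rightarrow> (real \<Rightarrow> real) \<Rightarrow> real" where
  "compound_quadrature l a x n f =
     1 / real n *
       (\<Sum>\<nu>=1..n. \<Sum>j=1..l. a j * f (-1 + 1 / real n * (x j + 2 * real \<nu> - 1)))"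

end

theory Submission
  imports Defs
begin

text \<open>
  On a subinterval with midpoint \<open>c\<close> and half-length \<open>r = 1/n\<close>, integrating the bound
  \<open>\<bar>g t - g c\<bar> \<le> W\<close>, with \<open>W\<close> the variation of \<open>g\<close> there, \<open>s\<close> times shows that \<open>f\<close> is within
  \<open>W * r ^ s\<close> of a polynomial of degree at most \<open>s\<close>. That polynomial is integrated exactly, so the local
  error is at most \<open>(2 + \<Sum>\<bar>a j\<bar>) * r ^ (s + 1) * W\<close>, and the local variations add up to at
  most the total variation of \<open>g\<close>.
\<close>

section \<open>Functions of bounded variation\<close>

text \<open>Every chain in \<open>{a..x}\<close> can be prolonged by the points \<open>x\<close> and
  \<open>y\<close>, which raises its sum by at least the last increment; the supremum inherits
  this.\<close>

lemma total_variation_extend: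
  assumes "a \<le> x" "x \<le> y"
  shows "total_variation a x g + ennreal \<bar>g y - g x\<bar> \<le> total_variation a y g"
proof -
  let ?P = "\<lambda>b. {(N::nat, t). mono_on {..N} t \<and> t ` {..N} \<subseteq> {a..b}}"
  let ?s = "\<lambda>(N::nat, t). ennreal (\<Sum>i<N. \<bar>g (t (Suc i)) - g (t i)\<bar>)"
  have "(0, \<lambda>_. a) \<in> ?P x"
    using assms by (auto simp: mono_on_def)
  then have ne: "?P x \<noteq> {}"
    by blast
  have "total_variation a x g + ennreal \<bar>g y - g x\<bar> = (SUP p\<in>?P x. ?s p + ennreal \<bar>g y - g x\<bar>)"
    unfolding total_variation_def by (rule ennreal_SUP_add_left[OF ne, symmetric])
  also have "\<dots> \<le> total_variation a y g"
  proof (rule SUP_least)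
    fix p assume "p \<in> ?P x"
    then obtain N t where p: "p = (N, t)" and mono: "mono_on {..N} t" and im: "t ` {..N} \<subseteq> {a..x}"
      by auto
    \<comment> \<open>Two points are appended because the last point \<open>t N\<close> need not be
      \<open>x\<close>. The increment from \<open>t N\<close> to \<open>x\<close> can only enlarge
      the sum.\<close>
    define t' where "t' i = (if i \<le> N then t i else if i = Suc N then x else y)" for i
    have bnd: "a \<le> t i" "t i \<le> x" if "i \<le> N" for i
      using im that by auto
    have "mono_on {..Suc (Suc N)} t'"
      unfolding mono_on_def t'_def using mono_onD[OF mono] bnd assms
      by (auto intro: order_trans[OF bnd(2)])
    moreover have "t' ` {..Suc (Suc N)} \<subseteq> {a..y}"
      unfolding t'_def using bnd(1) assms by (auto intro: order_trans[OF bnd(2)])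
    ultimately have mem: "(Suc (Suc N), t') \<in> ?P y"
      by auto
    have eq: "(\<Sum>i<N. \<bar>g (t' (Suc i)) - g (t' i)\<bar>) = (\<Sum>i<N. \<bar>g (t (Suc i)) - g (t i)\<bar>)"
      by (rule sum.cong) (auto simp: t'_def)
    have "?s p + ennreal \<bar>g y - g x\<bar> = ennreal ((\<Sum>i<N. \<bar>g (t (Suc i)) - g (t i)\<bar>) + \<bar>g y - g x\<bar>)"
      by (simp add: p ennreal_plus sum_nonneg)
    also have "\<dots> \<le> ennreal (\<Sum>i<Suc (Suc N). \<bar>g (t' (Suc i)) - g (t' i)\<bar>)"
      by (rule ennreal_leI) (use eq in \<open>simp add: t'_def\<close>)
    also have "\<dots> = ?s (Suc (Suc N), t')"
      by simp
    also have "\<dots> \<le> total_variation a y g"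
      unfolding total_variation_def using mem by (rule SUP_upper)
    finally show "?s p + ennreal \<bar>g y - g x\<bar> \<le> total_variation a y g" .
  qed
  finally show ?thesis .
qed

text \<open>\<open>V x\<close> is the variation of \<open>g\<close> on \<open>{a..x}\<close>. Its
  increments telescope, so oscillations on adjacent subintervals can be summed without additivity of
  the total variation.\<close>

lemma variation_majorant:
  assumes "a \<le> b" and fin: "total_variation a b g < \<infinity>"
  obtains V where "\<And>x y. a \<le> x \<Longrightarrow> x \<le> y \<Longrightarrow> y \<le> b \<Longrightarrow> \<bar>g y - g x\<bar> \<le> V y - V x"
    and "V b - V a \<le> enn2real (total_variation a b g)"
proof
  let ?V = "\<lambda>x. enn2real (total_variation a x g)"
  \<comment> \<open>\<open>enn2real\<close> sends infinity to 0, so finiteness on every initial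
    segment must be known before real differences are taken.\<close>
  have fin': "total_variation a x g < \<infinity>" if "a \<le> x" "x \<le> b" for x
  proof -
    have "total_variation a x g \<le> total_variation a x g + ennreal \<bar>g b - g x\<bar>"
      by simp
    then show ?thesis
      using total_variation_extend[OF that, of g] fin by (meson le_less_trans)
  qed
  show "\<bar>g y - g x\<bar> \<le> ?V y - ?V x" if "a \<le> x" "x \<le> y" "y \<le> b" for x y
  proof -
    have f: "total_variation a x g < top" "total_variation a y g < top"
      using fin'[of x] fin'[of y] that by auto
    have "enn2real (total_variation a x g + ennreal \<bar>g y - g x\<bar>) \<le> ?V y"
      by (rule enn2real_mono) (use total_variation_extend[of a x y g] that f in auto)
    moreover have "enn2real (total_variation a x g + ennreal \<bar>g y - g x\<bar>) = ?V x + \<bar>g y - g x\<bar>"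
      using f by (subst enn2real_plus) auto
    ultimately show ?thesis
      by linarith
  qed
  show "?V b - ?V a \<le> enn2real (total_variation a b g)"
    by simp
qed

text \<open>Jordan decomposition: \<open>g\<close> is the difference of the increasing functions
  \<open>V\<close> and \<open>V - g\<close>, and increasing functions are integrable on compact
  intervals.\<close>

lemma integrable_on_bounded_variation:
  assumes "a \<le> b" "total_variation a b g < \<infinity>"
  shows "g integrable_on {a..b}"
proof -
  obtain V where V: "\<And>x y. a \<le> x \<Longrightarrow> x \<le> y \<Longrightarrow> y \<le> b \<Longrightarrow> \<bar>g y - g x\<bar> \<le> V y - V x"
    using variation_majorant[OF assms] by metis
  have "mono_on {a..b} V"
  proof (rule mono_onI)
    fix x y assume "x \<in> {a..b}" "y \<in> {a..b}" "x \<le> y"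
    then show "V x \<le> V y" using V[of x y] by auto
  qed
  moreover have "mono_on {a..b} (\<lambda>x. V x - g x)"
  proof (rule mono_onI)
    fix x y assume "x \<in> {a..b}" "y \<in> {a..b}" "x \<le> y"
    then show "V x - g x \<le> V y - g y" using V[of x y] by auto
  qed
  ultimately have "(\<lambda>x. V x - (V x - g x)) integrable_on {a..b}"
    by (intro integrable_diff integrable_on_mono_on)
  then show ?thesis by simp
qed

section \<open>Absolutely continuous functions\<close>

lemma absolutely_continuous_fun_imp_continuous_on:
  assumes "absolutely_continuous_fun a b h"
  shows "continuous_on {a..b} h"
  unfolding continuous_on_iff
proof (intro ballI allI impI)
  fix x e :: real assume x: "x \<in> {a..b}" and "0 < e"
  then obtain d where "d > 0" and d: "\<And>(N::nat) u v. (\<forall>i<N. a \<le> u i \<and> u i \<le> v i \<and> v i \<le> b) \<and>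
        disjoint_family_on (\<lambda>i. {u i<..<v i}) {..<N} \<and> (\<Sum>i<N. v i - u i) < d
        \<Longrightarrow> (\<Sum>i<N. \<bar>h (v i) - h (u i)\<bar>) < e"
    using assms unfolding absolutely_continuous_fun_def by meson
  \<comment> \<open>The family consists of the single interval between \<open>x\<close> and
    \<open>y\<close>, in whichever order they lie.\<close>
  have "dist (h y) (h x) < e" if y: "y \<in> {a..b}" "dist y x < d" for y
    using d[of "Suc 0" "\<lambda>_. min x y" "\<lambda>_. max x y"] x y
    by (auto simp: disjoint_family_on_def dist_real_def min_def max_def abs_if split: if_splits)
  then show "\<exists>d>0. \<forall>y\<in>{a..b}. dist y x < d \<longrightarrow> dist (h y) (h x) < e"
    using \<open>d > 0\<close> by blast
qed

text \<open>The definition indexes families by initial segments of the naturals, whereas a tagged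
  division is a finite set of pairs. An enumeration of the index set carries the condition over,
  with the same \<open>d\<close>.\<close>

lemma absolutely_continuous_funD_finite:
  assumes ac: "absolutely_continuous_fun a b h" and "e > 0"
  shows "\<exists>d>0. \<forall>I (u :: 'i \<Rightarrow> real) v. finite I \<and> (\<forall>i\<in>I. a \<le> u i \<and> u i \<le> v i \<and> v i \<le> b) \<and>
        disjoint_family_on (\<lambda>i. {u i<..<v i}) I \<and> (\<Sum>i\<in>I. v i - u i) < d
        \<longrightarrow> (\<Sum>i\<in>I. \<bar>h (v i) - h (u i)\<bar>) < e"
proof -
  obtain d where "d > 0" and d: "\<And>(N::nat) u v. (\<forall>i<N. a \<le> u i \<and> u i \<le> v i \<and> v i \<le> b) \<and>
        disjoint_family_on (\<lambda>i. {u i<..<v i}) {..<N} \<and> (\<Sum>i<N. v i - u i) < d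
        \<Longrightarrow> (\<Sum>i<N. \<bar>h (v i) - h (u i)\<bar>) < e"
    using assms unfolding absolutely_continuous_fun_def by meson
  show ?thesis
  proof (intro exI[of _ d] conjI allI impI)
    show "d > 0" by fact
    fix I and u v :: "'i \<Rightarrow> real"
    assume "finite I \<and> (\<forall>i\<in>I. a \<le> u i \<and> u i \<le> v i \<and> v i \<le> b) \<and>
        disjoint_family_on (\<lambda>i. {u i<..<v i}) I \<and> (\<Sum>i\<in>I. v i - u i) < d"
    then have fin: "finite I" and uv: "\<And>i. i \<in> I \<Longrightarrow> a \<le> u i \<and> u i \<le> v i \<and> v i \<le> b"
      and disj: "disjoint_family_on (\<lambda>i. {u i<..<v i}) I" and less: "(\<Sum>i\<in>I. v i - u i) < d"
      by auto
    obtain e' where e': "bij_betw e' {..<card I} I"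
      using ex_bij_betw_nat_finite[OF fin] by (auto simp: atLeast0LessThan)
    have reindex: "(\<Sum>i<card I. F (e' i)) = sum F I" for F :: "'i \<Rightarrow> real"
      using sum.reindex_bij_betw[OF e'] .
    have "(\<Sum>i<card I. \<bar>h (v (e' i)) - h (u (e' i))\<bar>) < e"
    proof (rule d, intro conjI allI impI)
      fix i assume "i < card I"
      then have "e' i \<in> I" using bij_betwE[OF e'] by auto
      then show "a \<le> u (e' i)" "u (e' i) \<le> v (e' i)" "v (e' i) \<le> b"
        using uv by auto
    next
      show "disjoint_family_on (\<lambda>i. {u (e' i)<..<v (e' i)}) {..<card I}"
        unfolding disjoint_family_on_def
      proof (intro ballI impI)
        fix i j assume ij: "i \<in> {..<card I}" "j \<in> {..<card I}" "i \<noteq> j"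
        then have "e' i \<noteq> e' j"
          using bij_betw_imp_inj_on[OF e'] by (auto dest: inj_onD)
        moreover have "e' i \<in> I" "e' j \<in> I"
          using ij bij_betwE[OF e'] by auto
        ultimately show "{u (e' i)<..<v (e' i)} \<inter> {u (e' j)<..<v (e' j)} = {}"
          using disj by (auto simp: disjoint_family_on_def)
      qed
    next
      show "(\<Sum>i<card I. v (e' i) - u (e' i)) < d"
        using less reindex[of "\<lambda>i. v i - u i"] by simp
    qed
    then show "(\<Sum>i\<in>I. \<bar>h (v i) - h (u i)\<bar>) < e"
      using reindex[of "\<lambda>i. \<bar>h (v i) - h (u i)\<bar>"] by simp
  qed
qed

section \<open>A mean value inequality for derivatives that exist almost everywhere\<close>

text \<open>By disjointness the lengths add up to the measure of the union, which lies in
  \<open>U\<close>. This will control the intervals whose tags are exceptional.\<close>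

lemma sum_length_disjoint_intervals_le:
  fixes u v :: "'i \<Rightarrow> real"
  assumes "finite I" "\<And>i. i \<in> I \<Longrightarrow> u i \<le> v i \<and> {u i<..<v i} \<subseteq> U"
    and "disjoint_family_on (\<lambda>i. {u i<..<v i}) I" "U \<in> lmeasurable"
  shows "(\<Sum>i\<in>I. v i - u i) \<le> measure lebesgue U"
proof -
  have "(\<Sum>i\<in>I. v i - u i) = (\<Sum>i\<in>I. measure lebesgue {u i<..<v i})"
    using assms(2) by (intro sum.cong) auto
  also have "\<dots> = measure lebesgue (\<Union>i\<in>I. {u i<..<v i})"
    by (rule measure_finite_Union[symmetric]) (use assms in auto)
  also have "\<dots> \<le> measure lebesgue U"
    by (rule measure_mono_fmeasurable) (use assms in auto)
  finally show ?thesis .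
qed

text \<open>
  At a tag where the derivative exists the straddle estimate applies; the remaining tags form a null set,
  so their intervals can be confined to an open set of small measure, where absolute continuity
  makes the increments of \<open>h\<close> negligible.
\<close>

lemma absolutely_continuous_fun_mean_value_bound:
  assumes ac: "absolutely_continuous_fun a b h"
    and deriv: "AE x in lebesgue_on {a..b}. (h has_real_derivative g x) (at x within {a..b})"
    and sub: "a \<le> u" "u \<le> v" "v \<le> b"
    and bound: "\<And>x. x \<in> {u..v} \<Longrightarrow> \<bar>g x - \<gamma>\<bar> \<le> W"
  shows "\<bar>h v - h u - \<gamma> * (v - u)\<bar> \<le> W * (v - u)"
proof (rule field_le_epsilon)
  fix e0 :: real assume "e0 > 0"
  \<comment> \<open>The denominator collects the final coefficients of \<open>e\<close>:
    \<open>v - u\<close> from the tags in \<open>G\<close>, 1 from the increments of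
    \<open>h\<close> at the other tags, and \<open>\<bar>\<gamma>\<bar>\<close> from the lengths of
    their intervals.\<close>
  define e where "e = e0 / (v - u + 1 + \<bar>\<gamma>\<bar>)"
  have den: "v - u + 1 + \<bar>\<gamma>\<bar> > 0" using sub by linarith
  have "e > 0" using \<open>e0 > 0\<close> den by (simp add: e_def)
  obtain d where "d > 0" and d: "\<forall>I (l :: real \<times> real set \<Rightarrow> real) r. finite I \<and>
        (\<forall>i\<in>I. a \<le> l i \<and> l i \<le> r i \<and> r i \<le> b) \<and>
        disjoint_family_on (\<lambda>i. {l i<..<r i}) I \<and> (\<Sum>i\<in>I. r i - l i) < d
        \<longrightarrow> (\<Sum>i\<in>I. \<bar>h (r i) - h (l i)\<bar>) < e"
    using absolutely_continuous_funD_finite[OF ac \<open>e > 0\<close>] by blast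
  define G where "G = {x \<in> {a..b}. (h has_real_derivative g x) (at x within {a..b})}"
  \<comment> \<open>The almost everywhere statement only gives a null set containing the exceptional
    set; completeness of Lebesgue measure makes the exceptional set itself null.\<close>
  have null: "{a..b} - G \<in> null_sets lebesgue"
  proof -
    have "AE x in lebesgue. x \<notin> {a..b} - G"
      using deriv by (subst (asm) AE_restrict_space_iff) (auto simp: G_def elim: eventually_mono)
    then obtain N where "N \<in> null_sets lebesgue" "{a..b} - G \<subseteq> N"
      by (auto simp: eventually_ae_filter subset_eq)
    then show ?thesis
      by (meson negligible_iff_null_sets negligible_subset)
  qed
  \<comment> \<open>Measure below \<open>d\<close> will make the intervals inside \<open>U\<close>
    admissible for absolute continuity; measure below \<open>e\<close> will bound the contribution
    of the slope \<open>\<gamma>\<close> on them.\<close>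
  have pos: "min d e > 0" using \<open>d > 0\<close> \<open>e > 0\<close> by simp
  obtain U where U: "open U" "{a..b} - G \<subseteq> U" "U - ({a..b} - G) \<in> lmeasurable"
      and eU: "emeasure lebesgue (U - ({a..b} - G)) < ennreal (min d e)"
    using sets_lebesgue_outer_open[OF null_setsD2[OF null] pos] by metis
  have eU': "emeasure lebesgue U < ennreal (min d e)"
    using eU emeasure_Diff_null_set[OF null] U(1) by simp
  have Um: "U \<in> lmeasurable"
    using eU' U(1) by (auto simp: fmeasurable_def intro: order.strict_trans)
  have mU: "measure lebesgue U < min d e"
    using eU' Um \<open>d > 0\<close> \<open>e > 0\<close> by (simp add: emeasure_eq_measure2 ennreal_less_iff)
  have "\<exists>\<delta>>0. \<forall>y\<in>{a..b}. \<bar>y - x\<bar> < \<delta> \<longrightarrow> \<bar>h y - h x - g x * (y - x)\<bar> \<le> e * \<bar>y - x\<bar>" if "x \<in> G" for x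
    using that \<open>e > 0\<close> unfolding G_def has_field_derivative_def has_derivative_within_alt by auto
  then obtain \<delta> where \<delta>: "\<And>x. x \<in> G \<Longrightarrow> \<delta> x > 0"
    "\<And>x y. x \<in> G \<Longrightarrow> y \<in> {a..b} \<Longrightarrow> \<bar>y - x\<bar> < \<delta> x \<Longrightarrow> \<bar>h y - h x - g x * (y - x)\<bar> \<le> e * \<bar>y - x\<bar>"
    by metis
  \<comment> \<open>Fineness keeps an interval with tag in \<open>G\<close> within range of the
    derivative estimate and an interval with any other tag inside \<open>U\<close>. Points off
    \<open>{a..b}\<close> get \<open>UNIV\<close> because a gauge is defined on all reals.\<close>
  define ga where "ga x = (if x \<in> G then ball x (\<delta> x) else if x \<in> {a..b} then U else UNIV)" for x
  have "gauge ga"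
    using U \<delta>(1) by (intro gaugeI) (auto simp: ga_def)
  then obtain p where p: "p tagged_division_of {u..v}" and fine: "ga fine p"
    using fine_division_exists_real by blast
  let ?l = "\<lambda>z::real \<times> real set. Inf (snd z)" and ?r = "\<lambda>z::real \<times> real set. Sup (snd z)"
  have finp: "finite p" using p by blast
  have K: "u \<le> ?l z \<and> ?l z \<le> fst z \<and> fst z \<le> ?r z \<and> ?r z \<le> v"
    and Kmem: "?l z \<in> snd z \<and> ?r z \<in> snd z"
    and Kint: "interior (snd z) = {?l z<..<?r z}" if "z \<in> p" for z
  proof -
    obtain x K where z: "z = (x, K)" by force
    have "x \<in> K" "K \<subseteq> {u..v}" and "\<exists>a b. K = cbox a b"
      using tagged_division_ofD(2-4)[OF p] that z by blast+
    then obtain a' b' where "K = {a'..b'}" by auto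
    with z \<open>x \<in> K\<close> \<open>K \<subseteq> {u..v}\<close>
    show "u \<le> ?l z \<and> ?l z \<le> fst z \<and> fst z \<le> ?r z \<and> ?r z \<le> v"
      "?l z \<in> snd z \<and> ?r z \<in> snd z" "interior (snd z) = {?l z<..<?r z}"
      by auto
  qed
  have disj: "disjoint_family_on (\<lambda>z. {?l z<..<?r z}) p"
    unfolding disjoint_family_on_def
  proof (intro ballI impI)
    fix z w assume zw: "z \<in> p" "w \<in> p" "z \<noteq> w"
    then have "interior (snd z) \<inter> interior (snd w) = {}"
      using tagged_division_ofD(5)[OF p, of "fst z" "snd z" "fst w" "snd w"] by auto
    then show "{?l z<..<?r z} \<inter> {?l w<..<?r w} = {}"
      using Kint[OF zw(1)] Kint[OF zw(2)] by simp
  qed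
  have sumdiff: "(\<Sum>z\<in>p. F (?r z) - F (?l z)) = F v - F u" for F :: "real \<Rightarrow> real"
    using additive_tagged_division_1[OF sub(2) p, of F] by (simp add: case_prod_unfold)
  \<comment> \<open>\<open>D z\<close> is the increment of \<open>h x - \<gamma> * x\<close> over
    one interval, so its sum over \<open>p\<close> telescopes to the quantity to be bounded. The set
    \<open>q\<close> collects the exceptional tags.\<close>
  define D where "D z = h (?r z) - h (?l z) - \<gamma> * (?r z - ?l z)" for z
  define q where "q = {z \<in> p. fst z \<notin> G}"
  have q: "q \<subseteq> p" "finite q" using finp by (auto simp: q_def)
  have good: "\<bar>D z\<bar> \<le> (W + e) * (?r z - ?l z)" if "z \<in> p - q" for z
  proof -
    let ?x = "fst z"
    have z: "z \<in> p" and xG: "?x \<in> G" using that by (auto simp: q_def)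
    have sb: "snd z \<subseteq> ball ?x (\<delta> ?x)"
      using fineD[OF fine, of ?x "snd z"] z xG by (simp add: ga_def)
    note Kz = K[OF z]
    have "\<bar>?r z - ?x\<bar> < \<delta> ?x" "\<bar>?l z - ?x\<bar> < \<delta> ?x"
      using sb Kmem[OF z] by (auto simp: dist_real_def abs_minus_commute)
    then have "\<bar>h (?r z) - h ?x - g ?x * (?r z - ?x)\<bar> \<le> e * (?r z - ?x)"
      "\<bar>h (?l z) - h ?x - g ?x * (?l z - ?x)\<bar> \<le> e * (?x - ?l z)"
      using \<delta>(2)[OF xG, of "?r z"] \<delta>(2)[OF xG, of "?l z"] Kz sub by auto
    moreover have "\<bar>(g ?x - \<gamma>) * (?r z - ?l z)\<bar> \<le> W * (?r z - ?l z)"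
      using bound[of ?x] Kz by (simp add: abs_mult mult_right_mono)
    \<comment> \<open>Both end points are compared with the tag. As the tag lies between them, the
      two derivative errors add up to \<open>e\<close> times the length; replacing the slope
      \<open>g ?x\<close> by \<open>\<gamma>\<close> costs \<open>W\<close> times the
      length.\<close>
    moreover have "D z = (h (?r z) - h ?x - g ?x * (?r z - ?x)) - (h (?l z) - h ?x - g ?x * (?l z - ?x))
        + (g ?x - \<gamma>) * (?r z - ?l z)"
      by (simp add: D_def algebra_simps)
    moreover have "(W + e) * (?r z - ?l z) = e * (?r z - ?x) + e * (?x - ?l z) + W * (?r z - ?l z)"
      by (simp add: algebra_simps)
    ultimately show ?thesis by linarith
  qed
  have lenq: "(\<Sum>z\<in>q. ?r z - ?l z) \<le> measure lebesgue U"
  proof (rule sum_length_disjoint_intervals_le)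
    fix z assume "z \<in> q"
    then have z: "z \<in> p" "fst z \<notin> G" by (auto simp: q_def)
    have "fst z \<in> {a..b}" using K[OF z(1)] sub by auto
    then have "snd z \<subseteq> U"
      using fineD[OF fine, of "fst z" "snd z"] z by (simp add: ga_def)
    then show "?l z \<le> ?r z \<and> {?l z<..<?r z} \<subseteq> U"
      using K[OF z(1)] Kint[OF z(1)] interior_subset[of "snd z"] by auto
  qed (use q disjoint_family_on_mono[OF _ disj] Um in auto)
  have hq: "(\<Sum>z\<in>q. \<bar>h (?r z) - h (?l z)\<bar>) < e"
  proof (rule d[rule_format], intro conjI ballI)
    show "a \<le> ?l z" "?l z \<le> ?r z" "?r z \<le> b" if "z \<in> q" for z
      using K[of z] that q sub by auto
    show "(\<Sum>z\<in>q. ?r z - ?l z) < d"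
      using lenq mU by simp
  qed (use q disjoint_family_on_mono[OF _ disj] in auto)
  have bad: "(\<Sum>z\<in>q. \<bar>D z\<bar>) \<le> e + \<bar>\<gamma>\<bar> * e"
  proof -
    have "(\<Sum>z\<in>q. \<bar>D z\<bar>) \<le> (\<Sum>z\<in>q. \<bar>h (?r z) - h (?l z)\<bar> + \<bar>\<gamma>\<bar> * (?r z - ?l z))"
    proof (rule sum_mono)
      fix z assume "z \<in> q"
      then have "?l z \<le> ?r z" using K[of z] q by auto
      then have "\<bar>\<gamma> * (?r z - ?l z)\<bar> = \<bar>\<gamma>\<bar> * (?r z - ?l z)" by (simp add: abs_mult)
      then show "\<bar>D z\<bar> \<le> \<bar>h (?r z) - h (?l z)\<bar> + \<bar>\<gamma>\<bar> * (?r z - ?l z)"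
        unfolding D_def by linarith
    qed
    also have "\<dots> = (\<Sum>z\<in>q. \<bar>h (?r z) - h (?l z)\<bar>) + \<bar>\<gamma>\<bar> * (\<Sum>z\<in>q. ?r z - ?l z)"
      by (simp add: sum.distrib sum_distrib_left)
    also have "\<dots> \<le> e + \<bar>\<gamma>\<bar> * e"
      using hq lenq mU by (intro add_mono mult_left_mono) auto
    finally show ?thesis .
  qed
  have W: "W \<ge> 0" using bound[of u] sub by auto
  have "h v - h u - \<gamma> * (v - u) = (\<Sum>z\<in>p. D z)"
    using sumdiff[of "\<lambda>x. h x - \<gamma> * x"] by (simp add: D_def algebra_simps)
  also have "\<bar>\<dots>\<bar> \<le> (\<Sum>z\<in>p. \<bar>D z\<bar>)" by (rule sum_abs)
  also have "\<dots> = (\<Sum>z\<in>p - q. \<bar>D z\<bar>) + (\<Sum>z\<in>q. \<bar>D z\<bar>)"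
    by (rule sum.subset_diff) (use q finp in auto)
  also have "\<dots> \<le> (\<Sum>z\<in>p - q. (W + e) * (?r z - ?l z)) + (e + \<bar>\<gamma>\<bar> * e)"
    by (intro add_mono sum_mono good bad)
  \<comment> \<open>The intervals of \<open>q\<close> are put back, which adds nonnegative terms, so
    that the lengths telescope to \<open>v - u\<close>.\<close>
  also have "(\<Sum>z\<in>p - q. (W + e) * (?r z - ?l z)) \<le> (\<Sum>z\<in>p. (W + e) * (?r z - ?l z))"
  proof (rule sum_mono2)
    fix z assume "z \<in> p - (p - q)"
    then have "?l z \<le> ?r z" using K[of z] by auto
    then show "0 \<le> (W + e) * (?r z - ?l z)" using W \<open>e > 0\<close> by simp
  qed (use finp in auto)
  also have "(\<Sum>z\<in>p. (W + e) * (?r z - ?l z)) = (W + e) * (v - u)"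
    using sumdiff[of "\<lambda>x. x"] by (simp add: sum_distrib_left[symmetric])
  also have "(W + e) * (v - u) + (e + \<bar>\<gamma>\<bar> * e) = W * (v - u) + e * (v - u + 1 + \<bar>\<gamma>\<bar>)"
    by (simp add: algebra_simps)
  also have "\<dots> = W * (v - u) + e0"
    using den by (simp add: e_def)
  finally show "\<bar>h v - h u - \<gamma> * (v - u)\<bar> \<le> W * (v - u) + e0" by simp
qed

section \<open>Local polynomial approximation\<close>

text \<open>Coefficients are integrated termwise, and the free constant is then used to prescribe
  the value at \<open>c\<close>.\<close>

lemma poly_antiderivative_exists:
  fixes q :: "'a::field_char_0 poly"
  obtains P where "pderiv P = q" "degree P \<le> Suc (degree q)" "poly P c = y"
proof -
  define R where "R = (\<Sum>i\<le>degree q. monom (coeff q i / of_nat (Suc i)) (Suc i))"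
  have R: "pderiv R = q"
  proof -
    have "pderiv R = (\<Sum>i\<le>degree q. monom (coeff q i) i)"
      unfolding R_def using of_nat_neq_0[where 'a='a]
      by (simp add: higher_pderiv_sum[of "Suc 0", simplified] pderiv_monom del: of_nat_Suc)
    then show ?thesis by (simp add: poly_as_sum_of_monoms)
  qed
  have dR: "degree R \<le> Suc (degree q)"
    unfolding R_def by (intro degree_sum_le) (auto intro: order_trans[OF degree_monom_le])
  show thesis
  proof
    show "pderiv (R + [:y - poly R c:]) = q"
      by (simp add: pderiv_add R pderiv_pCons)
    show "degree (R + [:y - poly R c:]) \<le> Suc (degree q)"
      using dR by (intro degree_add_le) auto
    show "poly (R + [:y - poly R c:]) c = y" by simp
  qed
qed

lemma kth_derivative_on_continuous:
  assumes "kth_derivative_on a b k f h" "continuous_on {a..b} h"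
  shows "continuous_on {a..b} f"
  using assms
proof (induction k arbitrary: h)
  case 0
  then show ?case by (metis continuous_on_cong kth_derivative_on.simps(1))
next
  case (Suc k)
  then obtain h' where "kth_derivative_on a b k f h'"
    and "\<forall>x\<in>{a..b}. (h' has_real_derivative h x) (at x within {a..b})" by auto
  with Suc.IH show ?case by (meson DERIV_continuous_on)
qed

text \<open>Induction down the derivatives. The antiderivative of the approximating polynomial is
  normalised to agree at the midpoint \<open>c\<close>, so the mean value inequality multiplies the
  error by \<open>r\<close> and the degree rises by at most one. Hence \<open>h\<close>,
  \<open>q\<close> and \<open>B\<close> all vary in the induction.\<close>

lemma kth_derivative_on_poly_approx:
  assumes "kth_derivative_on a b k f h" and sub: "{c - r..c + r} \<subseteq> {a..b}" and "r \<ge> 0"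
    and "\<And>x. x \<in> {c - r..c + r} \<Longrightarrow> \<bar>h x - poly q x\<bar> \<le> B"
  obtains p where "degree p \<le> degree q + k"
    "\<And>x. x \<in> {c - r..c + r} \<Longrightarrow> \<bar>f x - poly p x\<bar> \<le> B * r ^ k"
  using assms(1,4)
proof (induction k arbitrary: h q B thesis)
  case 0
  show ?case
  proof (rule 0(1))
    show "\<bar>f x - poly q x\<bar> \<le> B * r ^ 0" if "x \<in> {c - r..c + r}" for x
    proof -
      have "h x = f x" using 0(2) that sub by auto
      then show ?thesis using 0(3)[OF that] by simp
    qed
  qed simp
next
  case (Suc k)
  then obtain h' where h': "kth_derivative_on a b k f h'"
    and der: "\<And>x. x \<in> {a..b} \<Longrightarrow> (h' has_real_derivative h x) (at x within {a..b})" by auto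
  obtain P where P: "pderiv P = q" "degree P \<le> Suc (degree q)" "poly P c = h' c"
    using poly_antiderivative_exists by blast
  have "B \<ge> 0" using Suc.prems(3)[of c] \<open>r \<ge> 0\<close> by auto
  have "\<bar>h' x - poly P x\<bar> \<le> B * r" if x: "x \<in> {c - r..c + r}" for x
  proof -
    have "norm ((h' x - poly P x) - (h' c - poly P c)) \<le> B * norm (x - c)"
    proof (rule field_differentiable_bound)
      show "convex {c - r..c + r}" by simp
      fix z assume z: "z \<in> {c - r..c + r}"
      have "(h' has_real_derivative h z) (at z within {c - r..c + r})"
        using der[of z] z sub by (meson DERIV_subset subsetD)
      moreover have "(poly P has_real_derivative poly q z) (at z within {c - r..c + r})"
        using poly_DERIV[of P z] P(1) has_field_derivative_at_within by blast
      ultimately show "((\<lambda>x. h' x - poly P x) has_field_derivative h z - poly q z) (at z within {c - r..c + r})"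
        by (rule DERIV_diff)
      show "norm (h z - poly q z) \<le> B" using Suc.prems(3)[OF z] by simp
    qed (use x \<open>r \<ge> 0\<close> in auto)
    also have "\<dots> \<le> B * r"
      using x \<open>B \<ge> 0\<close> by (intro mult_left_mono) auto
    finally show ?thesis using P(3) by simp
  qed
  then obtain p where "degree p \<le> degree P + k"
    "\<And>x. x \<in> {c - r..c + r} \<Longrightarrow> \<bar>f x - poly p x\<bar> \<le> (B * r) * r ^ k"
    using Suc.IH[OF _ h'] by blast
  with P(2) show ?case
    by (intro Suc.prems(1)[of p]) (auto simp: algebra_simps)
qed

text \<open>The top integration is treated separately: \<open>g\<close> is a derivative only almost
  everywhere, so the bound for absolutely continuous functions takes the place of the classical mean
  value inequality. The other \<open>s - 1\<close> derivatives exist everywhere. For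
  \<open>s = 0\<close> the constant \<open>g c\<close> serves.\<close>

lemma bv_derivative_poly_approx:
  assumes "bv_derivative s f g" and sub: "{c - r..c + r} \<subseteq> {-1..1}" and "r \<ge> 0"
    and osc: "\<And>x. x \<in> {c - r..c + r} \<Longrightarrow> \<bar>g x - g c\<bar> \<le> W"
  obtains p where "degree p \<le> s"
    "\<And>x. x \<in> {c - r..c + r} \<Longrightarrow> \<bar>f x - poly p x\<bar> \<le> W * r ^ s"
proof (cases s)
  case 0
  show thesis
  proof (rule that)
    show "degree [:g c:] \<le> s" by simp
    show "\<bar>f x - poly [:g c:] x\<bar> \<le> W * r ^ s" if "x \<in> {c - r..c + r}" for x
      using osc[OF that] assms(1) 0 that sub by auto
  qed
next
  case (Suc k)
  then obtain h where h: "kth_derivative_on (-1) 1 k f h"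
    and ac: "absolutely_continuous_fun (-1) 1 h"
    and ae: "AE x in lebesgue_on {-1..1}. (h has_real_derivative g x) (at x within {-1..1})"
    using assms(1) by auto
  \<comment> \<open>The line through \<open>(c, h c)\<close> with slope \<open>g c\<close>; it need
    not be a tangent, since \<open>g c\<close> may differ from the derivative of \<open>h\<close> at
    \<open>c\<close>.\<close>
  define q where "q = [:h c - g c * c, g c:]"
  have W: "W \<ge> 0" using osc[of c] \<open>r \<ge> 0\<close> by auto
  have ends: "-1 \<le> c - r" "c + r \<le> 1" using sub \<open>r \<ge> 0\<close> by auto
  have "\<bar>h x - poly q x\<bar> \<le> W * r" if x: "x \<in> {c - r..c + r}" for x
  proof -
    \<comment> \<open>Ordering \<open>x\<close> and \<open>c\<close> lets one application of the
      bound cover both sides of the midpoint.\<close>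
    define y z where "y = min x c" and "z = max x c"
    have "\<bar>h z - h y - g c * (z - y)\<bar> \<le> W * (z - y)"
    proof (rule absolutely_continuous_fun_mean_value_bound[OF ac ae])
      show "\<bar>g t - g c\<bar> \<le> W" if "t \<in> {y..z}" for t
        using osc[of t] that x by (auto simp: y_def z_def min_def max_def split: if_splits)
    qed (use x ends \<open>r \<ge> 0\<close> in \<open>auto simp: y_def z_def\<close>)
    also have "\<dots> \<le> W * r"
      using x W by (intro mult_left_mono) (auto simp: y_def z_def)
    also have "\<bar>h z - h y - g c * (z - y)\<bar> = \<bar>h x - poly q x\<bar>"
      by (auto simp: y_def z_def q_def min_def max_def algebra_simps)
    finally show ?thesis .
  qed
  then obtain p where p: "degree p \<le> degree q + k"
    "\<And>x. x \<in> {c - r..c + r} \<Longrightarrow> \<bar>f x - poly p x\<bar> \<le> (W * r) * r ^ k"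
    using kth_derivative_on_poly_approx[OF h sub \<open>r \<ge> 0\<close>] by blast
  have "degree q \<le> 1" by (simp add: q_def)
  with p Suc show thesis
    by (intro that[of p]) (auto simp: algebra_simps)
qed

text \<open>Needed to split the integral over subintervals and to subtract polynomials under it.
  Bounded variation gives it for \<open>s = 0\<close>, continuity of \<open>f\<close> for larger
  \<open>s\<close>.\<close>

lemma bv_derivative_integrable:
  assumes "bv_derivative s f g"
  shows "f integrable_on {-1..1}"
proof (cases s)
  case 0
  then have "g integrable_on {-1..1}"
    using assms by (intro integrable_on_bounded_variation) auto
  then show ?thesis
    using 0 assms by (subst integrable_cong[of _ _ g]) auto
next
  case (Suc k)
  then obtain h where "kth_derivative_on (-1) 1 k f h" "absolutely_continuous_fun (-1) 1 h"
    using assms by auto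
  then show ?thesis
    by (intro integrable_continuous_real)
      (blast intro: kth_derivative_on_continuous absolutely_continuous_fun_imp_continuous_on)
qed

section \<open>The quadrature error\<close>

text \<open>An affine substitution preserves the degree, so exactness on \<open>{-1..1}\<close>
  carries over to any subinterval, with the weights scaled by its half-length
  \<open>r\<close>.\<close>

lemma quadrature_exact_affine:
  fixes p :: "real poly"
  assumes exact: "\<forall>p::real poly. degree p \<le> m \<longrightarrow> quadrature l a x (poly p) = integral {-1..1} (poly p)"
    and "degree p \<le> m" "r > 0"
  shows "r * quadrature l a x (\<lambda>y. poly p (c + r * y)) = integral {c - r..c + r} (poly p)"
proof -
  let ?q = "p \<circ>\<^sub>p [:c, r:]"
  have q: "poly ?q = (\<lambda>y. poly p (c + r * y))"
    by (simp add: poly_pcompose fun_eq_iff mult.commute)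
  have "((poly p) has_integral integral {c - r..c + r} (poly p)) (cbox (c - r) (c + r))"
    by (auto intro!: integrable_integral integrable_continuous_real continuous_intros)
  from has_integral_affinity'[OF this \<open>r > 0\<close>, of c]
  have "((\<lambda>y. poly p (c + r * y)) has_integral integral {c - r..c + r} (poly p) / r) {-1..1}"
    using \<open>r > 0\<close> by (simp add: add.commute divide_inverse mult.commute)
  then have "integral {-1..1} (poly ?q) = integral {c - r..c + r} (poly p) / r"
    unfolding q by (rule integral_unique)
  moreover have "degree ?q \<le> m"
    using assms by (simp add: degree_pcompose)
  ultimately show ?thesis
    using exact q \<open>r > 0\<close> by (metis nonzero_mult_div_cancel_left less_irrefl times_divide_eq_right)
qed

text \<open>The rule is exact for \<open>p\<close>, so only \<open>f - p\<close> contributes. Its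
  integral over an interval of length \<open>2 * r\<close> gives the constant 2, and its quadrature
  sum gives the sum of the absolute weights.\<close>

lemma local_quadrature_error:
  assumes nodes_in: "\<forall>j\<in>{1..l}. x j \<in> {-1..1}"
    and exact: "\<forall>p::real poly. degree p \<le> m \<longrightarrow> quadrature l a x (poly p) = integral {-1..1} (poly p)"
    and "degree p \<le> m" "r > 0" and int: "f integrable_on {c - r..c + r}"
    and approx: "\<And>y. y \<in> {c - r..c + r} \<Longrightarrow> \<bar>f y - poly p y\<bar> \<le> B"
  shows "\<bar>integral {c - r..c + r} f - r * quadrature l a x (\<lambda>y. f (c + r * y))\<bar>
           \<le> (2 + (\<Sum>j=1..l. \<bar>a j\<bar>)) * r * B"
proof -
  have B: "B \<ge> 0" using approx[of c] \<open>r > 0\<close> by auto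
  have intp: "poly p integrable_on {c - r..c + r}"
    by (auto intro!: integrable_continuous_real continuous_intros)
  have 1: "\<bar>integral {c - r..c + r} f - integral {c - r..c + r} (poly p)\<bar> \<le> B * (2 * r)"
  proof -
    have "norm (integral {c - r..c + r} (\<lambda>y. f y - poly p y)) \<le> integral {c - r..c + r} (\<lambda>_. B)"
      by (rule integral_norm_bound_integral) (use int intp approx in \<open>auto intro: integrable_diff\<close>)
    then show ?thesis
      using int intp \<open>r > 0\<close> by (simp add: integral_diff mult.commute mult.left_commute)
  qed
  have "\<bar>quadrature l a x (\<lambda>y. f (c + r * y)) - quadrature l a x (\<lambda>y. poly p (c + r * y))\<bar>
      = \<bar>\<Sum>j=1..l. a j * (f (c + r * x j) - poly p (c + r * x j))\<bar>"
    by (simp add: quadrature_def sum_subtractf right_diff_distrib)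
  also have "\<dots> \<le> (\<Sum>j=1..l. \<bar>a j * (f (c + r * x j) - poly p (c + r * x j))\<bar>)"
    by (rule sum_abs)
  also have "\<dots> \<le> (\<Sum>j=1..l. \<bar>a j\<bar> * B)"
  proof (rule sum_mono)
    fix j assume "j \<in> {1..l}"
    then have "-1 \<le> x j" "x j \<le> 1" using nodes_in by auto
    then have "r * -1 \<le> r * x j" "r * x j \<le> r * 1"
      using \<open>r > 0\<close> by (intro mult_left_mono; simp)+
    then have "\<bar>f (c + r * x j) - poly p (c + r * x j)\<bar> \<le> B"
      by (intro approx) auto
    then show "\<bar>a j * (f (c + r * x j) - poly p (c + r * x j))\<bar> \<le> \<bar>a j\<bar> * B"
      by (simp add: abs_mult mult_left_mono)
  qed
  also have "\<dots> = (\<Sum>j=1..l. \<bar>a j\<bar>) * B" by (simp add: sum_distrib_right)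
  finally have "r * \<bar>quadrature l a x (\<lambda>y. f (c + r * y)) - quadrature l a x (\<lambda>y. poly p (c + r * y))\<bar>
      \<le> r * ((\<Sum>j=1..l. \<bar>a j\<bar>) * B)"
    using \<open>r > 0\<close> by simp
  then have 2: "\<bar>r * quadrature l a x (\<lambda>y. f (c + r * y)) - integral {c - r..c + r} (poly p)\<bar>
      \<le> r * ((\<Sum>j=1..l. \<bar>a j\<bar>) * B)"
    using quadrature_exact_affine[OF exact assms(3,4), of c] \<open>r > 0\<close>
    by (metis abs_mult abs_of_pos right_diff_distrib)
  have "(2 + (\<Sum>j=1..l. \<bar>a j\<bar>)) * r * B = B * (2 * r) + r * ((\<Sum>j=1..l. \<bar>a j\<bar>) * B)"
    by (simp add: algebra_simps)
  then show ?thesis using 1 2 by linarith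
qed

section \<open>Summation of the local errors\<close>

lemma integral_sum_adjacent:
  fixes f :: "real \<Rightarrow> 'a::banach"
  assumes "incseq t" "f integrable_on {t 0..t n}"
  shows "(\<Sum>i<n. integral {t i..t (Suc i)} f) = integral {t 0..t n} f"
  using assms(2)
proof (induction n)
  case (Suc n)
  have le: "t 0 \<le> t n" "t n \<le> t (Suc n)" using assms(1) by (auto simp: incseq_def)
  then have "f integrable_on {t 0..t n}"
    using Suc.prems by (auto intro: integrable_on_subinterval)
  then show ?case
    using Suc.IH Henstock_Kurzweil_Integration.integral_combine[OF le Suc.prems] by simp
qed simp

theorem theorem2:
  fixes l m :: nat and a x :: "nat \<Rightarrow> real"
  assumes nodes_increasing: "strict_mono_on {1..l} x"
    and nodes_in: "\<forall>j\<in>{1..l}. x j \<in> {-1..1}"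
    and exact: "\<forall>p::real poly. degree p \<le> m \<longrightarrow>
                  quadrature l a x (poly p) = integral {-1..1} (poly p)"
  shows "\<forall>s\<in>{0..m}. \<exists>C::real. \<forall>n\<ge>1. \<forall>f\<in>V_class s. \<forall>g. bv_derivative s f g \<longrightarrow>
           \<bar>integral {-1..1} f - compound_quadrature l a x n f\<bar>
             \<le> C * real n powi (- int s - 1) * enn2real (total_variation (-1) 1 g)"
\<comment> \<open>The constant stays schematic here and becomes \<open>?C\<close>, built from the
  weights alone. It is introduced before \<open>n\<close>, \<open>f\<close> and \<open>g\<close> and
  so cannot depend on them.\<close>
proof (intro ballI exI allI impI)
  fix s n :: nat and f g :: "real \<Rightarrow> real"
  assume s: "s \<in> {0..m}" and n: "1 \<le> n" and bv: "bv_derivative s f g"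
  let ?C = "2 + (\<Sum>j=1..l. \<bar>a j\<bar>)"
  \<comment> \<open>Half-length, grid points and midpoints of the subintervals. Counting starts at
    0, so index \<open>i\<close> belongs to \<nu> = i + 1 in the compound formula, and
    \<open>2 * i + 1\<close> is 2\<nu> - 1.\<close>
  define r t c where "r = 1 / real n" and "t i = -1 + 2 * real i * r" and "c i = -1 + (2 * real i + 1) * r"
    for i :: nat
  have r: "r > 0" using n by (simp add: r_def)
  have t: "t i = c i - r" "t (Suc i) = c i + r" for i
    by (simp_all add: t_def c_def algebra_simps)
  have inc: "incseq t"
    using r by (auto simp: incseq_def t_def)
  have t0: "t 0 = -1" and tn: "t n = 1"
    using n by (simp_all add: t_def r_def)
  have fin: "total_variation (-1) 1 g < \<infinity>"
    using bv by (cases s) auto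
  obtain V where V: "\<And>x y. -1 \<le> x \<Longrightarrow> x \<le> y \<Longrightarrow> y \<le> 1 \<Longrightarrow> \<bar>g y - g x\<bar> \<le> V y - V x"
    and Vtot: "V 1 - V (-1) \<le> enn2real (total_variation (-1) 1 g)"
    using variation_majorant[OF _ fin] by auto
  let ?Q = "\<lambda>i. r * quadrature l a x (\<lambda>y. f (c i + r * y))"
  have intf: "f integrable_on {-1..1}" using bv by (rule bv_derivative_integrable)
  have local: "\<bar>integral {t i..t (Suc i)} f - ?Q i\<bar> \<le> ?C * r ^ Suc s * (V (t (Suc i)) - V (t i))"
    if i: "i < n" for i
  proof -
    have "t 0 \<le> t i" "t (Suc i) \<le> t n"
      using inc i by (auto intro: incseqD)
    then have ends: "-1 \<le> c i - r" "c i + r \<le> 1"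
      using t0 tn t by auto
    then have sub: "{c i - r..c i + r} \<subseteq> {-1..1}" by auto
    \<comment> \<open>Increments of \<open>V\<close> dominate absolute values and are thus
      nonnegative, so the increment between \<open>y\<close> and \<open>c i\<close> may be enlarged
      to the one over the whole subinterval.\<close>
    have osc: "\<bar>g y - g (c i)\<bar> \<le> V (c i + r) - V (c i - r)" if y: "y \<in> {c i - r..c i + r}" for y
    proof (cases "y \<le> c i")
      case True
      then show ?thesis
        using V[of y "c i"] V[of "c i - r" y] V[of "c i" "c i + r"] y ends r by auto
    next
      case False
      then show ?thesis
        using V[of "c i" y] V[of "c i - r" "c i"] V[of y "c i + r"] y ends r by auto
    qed
    obtain p where p: "degree p \<le> s"
      "\<And>y. y \<in> {c i - r..c i + r} \<Longrightarrow> \<bar>f y - poly p y\<bar> \<le> (V (c i + r) - V (c i - r)) * r ^ s"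
      using bv_derivative_poly_approx[OF bv sub _ osc] r by auto
    have "\<bar>integral {c i - r..c i + r} f - ?Q i\<bar> \<le> ?C * r * ((V (c i + r) - V (c i - r)) * r ^ s)"
      by (rule local_quadrature_error[OF nodes_in exact _ r _ p(2)])
        (use p(1) s sub integrable_on_subinterval[OF intf] in auto)
    also have "\<dots> = ?C * r ^ Suc s * (V (c i + r) - V (c i - r))"
      by (simp add: mult_ac)
    \<comment> \<open>The right end must be unfolded first: the equation for \<open>t i\<close> also
      matches \<open>t (Suc i)\<close> and would express it by the next midpoint.\<close>
    finally show ?thesis unfolding t(2) unfolding t(1) .
  qed
  have "compound_quadrature l a x n f = (\<Sum>i<n. ?Q i)"
  proof -
    have "compound_quadrature l a x n f
        = (\<Sum>\<nu>=1..n. r * quadrature l a x (\<lambda>y. f (-1 + r * (y + 2 * real \<nu> - 1))))"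
      by (simp add: compound_quadrature_def quadrature_def r_def sum_distrib_left)
    also have "\<dots> = (\<Sum>i<n. r * quadrature l a x (\<lambda>y. f (-1 + r * (y + 2 * real (Suc i) - 1))))"
      by (rule sum.reindex_bij_witness[of _ Suc "\<lambda>i. i - 1"]) auto
    also have "\<dots> = (\<Sum>i<n. ?Q i)"
      by (simp add: c_def algebra_simps)
    finally show ?thesis .
  qed
  moreover have "integral {-1..1} f = (\<Sum>i<n. integral {t i..t (Suc i)} f)"
    using integral_sum_adjacent[OF inc, of f n] intf t0 tn by simp
  ultimately have "\<bar>integral {-1..1} f - compound_quadrature l a x n f\<bar>
      = \<bar>\<Sum>i<n. integral {t i..t (Suc i)} f - ?Q i\<bar>"
    by (simp add: sum_subtractf)
  also have "\<dots> \<le> (\<Sum>i<n. \<bar>integral {t i..t (Suc i)} f - ?Q i\<bar>)"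
    by (rule sum_abs)
  also have "\<dots> \<le> (\<Sum>i<n. ?C * r ^ Suc s * (V (t (Suc i)) - V (t i)))"
    by (intro sum_mono local) auto
  also have "\<dots> = ?C * r ^ Suc s * (V 1 - V (-1))"
    using t0 tn by (simp add: sum_distrib_left[symmetric] sum_lessThan_telescope[of "\<lambda>i. V (t i)"])
  also have "\<dots> \<le> ?C * r ^ Suc s * enn2real (total_variation (-1) 1 g)"
    using Vtot r by (intro mult_left_mono) (auto intro!: mult_nonneg_nonneg add_nonneg_nonneg sum_nonneg)
  \<comment> \<open>One power of \<open>r\<close> stems from rescaling the interval, the other
    \<open>s\<close> from the polynomial approximation.\<close>
  also have "r ^ Suc s = real n powi (- int s - 1)"
  proof -
    have "- int s - 1 = - int (Suc s)" by simp
    then show ?thesis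
      by (simp only: power_int_minus power_int_of_nat r_def power_one_over inverse_eq_divide)
  qed
  finally show "\<bar>integral {-1..1} f - compound_quadrature l a x n f\<bar>
      \<le> ?C * real n powi (- int s - 1) * enn2real (total_variation (-1) 1 g)" .
qed

end
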